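(* (1) For a classical metric space $X$, the normed category $\mathrm iX$ is Cauchy cocomplete if, and only if, $X$ is complete in the ordinary sense. (2) If the ordinary category $\mathbb X$ has colimits of sequences lying in a wide subcategory $\mathcal S$ that satisfies Condition (S), then the $\mathsf 2$-normed category $(\mathbb X,\mathcal S)$ is Cauchy cocomplete if, and only if, the category $\mathcal S$ (as a category in its own right) has colimits of sequences.
   Context: A sequence in a category $\mathbb X$ is a functor $s:\mathbb N\to\mathbb X$ from the ordered set $\mathbb N$, written $s=(s_{m,n}:x_m\to x_n)_{m\le n}$. Normed categories, for (1): A normed category is a category $\mathbb X$ with a value $|f|\in[0,\infty]$ for every morphism $f$ such that $|1_x|=0$ and $|g\cdot f|\le|f|+|g|$ for all objects $x$ and all composable $f:x\to y$, $g:y\to z$. A sequence $s$ in $\mathbb X$ is Cauchy if $\inf_{N}\sup_{n\ge m\ge N}|s_{m,n}|=0$. A normed colimit of $s$ is an object $x$ with a cocone $\gamma=(\gamma_n:x_n\to x)_n$ which is a colimit cocone of $s$ in the ordinary category $\mathbb X$ such that, for every morphism $f$ with domain $x$, $|f|=\inf_{N}\sup_{n\ge N}|f\cdot\gamma_n|$. A classical metric space has a symmetric, separated, finite-valued metric. For such a space $X$, with $X(x,y)$ denoting the distance from $x$ to $y$, $\mathrm iX$ is the normed category whose objects are the points of $X$, with exactly one morphism $x\to y$ for all $x,y\in X$, normed by $|x\to y|=X(x,y)$. $\mathsf 2$-normed categories, for (2): A $\mathsf 2$-normed category $(\mathbb X,\mathcal S)$ is a category $\mathbb X$ equipped with a wide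 subcategory $\mathcal S$, that is, a class $\mathcal S$ of morphisms of $\mathbb X$ which contains all identity morphisms and is closed under composition (a norm with values in the Boolean quantale $\mathsf 2=\{\bot,\top\}$, with $|f|=\top$ exactly when $f\in\mathcal S$). A sequence $s$ in $\mathbb X$ is Cauchy if there is $N$ with $s_{m,n}\in\mathcal S$ for all $n\ge m\ge N$. A normed colimit of $s$ is an object $x$ with a cocone $\gamma=(\gamma_n:x_n\to x)_n$ which is a colimit cocone of $s$ in the ordinary category $\mathbb X$ such that, for every morphism $f$ with domain $x$, one has $f\in\mathcal S$ if, and only if, there is $N$ with $f\cdot\gamma_n\in\mathcal S$ for all $n\ge N$. Condition (S) for $\mathcal S$ says: for all composable morphisms $h$ and $f$ of $\mathbb X$, if $f\cdot h\in\mathcal S$ and $h\in\mathcal S$, then $f\in\mathcal S$. In both cases, the (normed or $\mathsf 2$-normed) category is Cauchy cocomplete if every Cauchy sequence in it has a normed colimit in it.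
   Formalization: In (2), "the category S has colimits of sequences" is strengthened to also require that the inclusion of S into X preserves these colimits; without this the "if" direction is false, and Cauchy cocompleteness implies it. *)

theory Defs
  imports "HOL-Analysis.Analysis"
begin

section \<open>Categories, sequences and colimits\<close>

text \<open>
  \<open>Cmp X g f\<close> is \<open>g \<cdot> f\<close> (first \<open>f\<close>, then \<open>g\<close>); it is meaningful only if \<open>Cod X f = Dom X g\<close>.
\<close>

record ('o, 'm) cat =
  Obj :: "'o set"
  Mor :: "'m set"
  Dom :: "'m \<Rightarrow> 'o"
  Cod :: "'m \<Rightarrow> 'o"
  Id  :: "'o \<Rightarrow> 'm"
  Cmp :: "'m \<Rightarrow> 'm \<Rightarrow> 'm"

definition hom :: "('o, 'm) cat \<Rightarrow> 'o \<Rightarrow> 'o \<Rightarrow> 'm set" where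
  "hom X a b = {f \<in> Mor X. Dom X f = a \<and> Cod X f = b}"

locale category =
  fixes X :: "('o, 'm) cat"
  assumes Dom_Obj: "f \<in> Mor X \<Longrightarrow> Dom X f \<in> Obj X"
    and Cod_Obj: "f \<in> Mor X \<Longrightarrow> Cod X f \<in> Obj X"
    and Id_hom: "a \<in> Obj X \<Longrightarrow> Id X a \<in> hom X a a"
    and Cmp_hom: "f \<in> hom X a b \<Longrightarrow> g \<in> hom X b c \<Longrightarrow> Cmp X g f \<in> hom X a c"
    and Id_left: "f \<in> hom X a b \<Longrightarrow> Cmp X (Id X b) f = f"
    and Id_right: "f \<in> hom X a b \<Longrightarrow> Cmp X f (Id X a) = f"
    and assoc: "f \<in> hom X a b \<Longrightarrow> g \<in> hom X b c \<Longrightarrow> h \<in> hom X c d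
                 \<Longrightarrow> Cmp X h (Cmp X g f) = Cmp X (Cmp X h g) f"

text \<open>
  A functor from the ordered set of natural numbers: objects \<open>x n\<close> and morphisms
  \<open>s m n : x m \<rightarrow> x n\<close> for \<open>m \<le> n\<close>; the values \<open>s m n\<close> with \<open>n < m\<close> are irrelevant.
\<close>

definition is_sequence :: "('o, 'm) cat \<Rightarrow> (nat \<Rightarrow> 'o) \<Rightarrow> (nat \<Rightarrow> nat \<Rightarrow> 'm) \<Rightarrow> bool" where
  "is_sequence X x s \<longleftrightarrow>
     (\<forall>n. x n \<in> Obj X) \<and>
     (\<forall>m n. m \<le> n \<longrightarrow> s m n \<in> hom X (x m) (x n)) \<and>
     (\<forall>n. s n n = Id X (x n)) \<and>
     (\<forall>k m n. k \<le> m \<longrightarrow> m \<le> n \<longrightarrow> s k n = Cmp X (s m n) (s k m))"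

definition is_cocone ::
  "('o, 'm) cat \<Rightarrow> (nat \<Rightarrow> 'o) \<Rightarrow> (nat \<Rightarrow> nat \<Rightarrow> 'm) \<Rightarrow> 'o \<Rightarrow> (nat \<Rightarrow> 'm) \<Rightarrow> bool" where
  "is_cocone X x s c \<gamma> \<longleftrightarrow>
     c \<in> Obj X \<and>
     (\<forall>n. \<gamma> n \<in> hom X (x n) c) \<and>
     (\<forall>m n. m \<le> n \<longrightarrow> Cmp X (\<gamma> n) (s m n) = \<gamma> m)"

definition is_colimit ::
  "('o, 'm) cat \<Rightarrow> (nat \<Rightarrow> 'o) \<Rightarrow> (nat \<Rightarrow> nat \<Rightarrow> 'm) \<Rightarrow> 'o \<Rightarrow> (nat \<Rightarrow> 'm) \<Rightarrow> bool" where
  "is_colimit X x s c \<gamma> \<longleftrightarrow>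
     is_cocone X x s c \<gamma> \<and>
     (\<forall>y \<delta>. is_cocone X x s y \<delta> \<longrightarrow> (\<exists>!f. f \<in> hom X c y \<and> (\<forall>n. Cmp X f (\<gamma> n) = \<delta> n)))"

definition has_sequential_colimits :: "('o, 'm) cat \<Rightarrow> bool" where
  "has_sequential_colimits X \<longleftrightarrow>
     (\<forall>x s. is_sequence X x s \<longrightarrow> (\<exists>c \<gamma>. is_colimit X x s c \<gamma>))"


section \<open>Normed categories\<close>

locale normed_category = category X
  for X :: "('o, 'm) cat" +
  fixes nrm :: "'m \<Rightarrow> ennreal"
  assumes nrm_Id: "a \<in> Obj X \<Longrightarrow> nrm (Id X a) = 0"
    and nrm_Cmp: "f \<in> hom X a b \<Longrightarrow> g \<in> hom X b c \<Longrightarrow> nrm (Cmp X g f) \<le> nrm f + nrm g"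

definition Cauchy_seq :: "('m \<Rightarrow> ennreal) \<Rightarrow> (nat \<Rightarrow> nat \<Rightarrow> 'm) \<Rightarrow> bool" where
  "Cauchy_seq nrm s \<longleftrightarrow> (INF N. SUP (m, n) \<in> {(m, n). N \<le> m \<and> m \<le> n}. nrm (s m n)) = 0"

definition is_normed_colimit ::
  "('o, 'm) cat \<Rightarrow> ('m \<Rightarrow> ennreal) \<Rightarrow> (nat \<Rightarrow> 'o) \<Rightarrow> (nat \<Rightarrow> nat \<Rightarrow> 'm) \<Rightarrow> 'o \<Rightarrow> (nat \<Rightarrow> 'm) \<Rightarrow> bool"
  where
  "is_normed_colimit X nrm x s c \<gamma> \<longleftrightarrow>
     is_colimit X x s c \<gamma> \<and>
     (\<forall>f \<in> Mor X. Dom X f = c \<longrightarrow> nrm f = (INF N. SUP n \<in> {N..}. nrm (Cmp X f (\<gamma> n))))"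

definition Cauchy_cocomplete :: "('o, 'm) cat \<Rightarrow> ('m \<Rightarrow> ennreal) \<Rightarrow> bool" where
  "Cauchy_cocomplete X nrm \<longleftrightarrow>
     (\<forall>x s. is_sequence X x s \<and> Cauchy_seq nrm s \<longrightarrow> (\<exists>c \<gamma>. is_normed_colimit X nrm x s c \<gamma>))"

text \<open>The normed category \<open>iX\<close> of a metric space; the morphism \<open>x \<rightarrow> y\<close> is the pair \<open>(x, y)\<close>.\<close>

definition indiscrete_cat :: "'p set \<Rightarrow> ('p, 'p \<times> 'p) cat" where
  "indiscrete_cat M =
     \<lparr> Obj = M, Mor = M \<times> M, Dom = fst, Cod = snd, Id = (\<lambda>x. (x, x)), Cmp = (\<lambda>g f. (fst f, snd g)) \<rparr>"

definition dist_norm :: "('p \<Rightarrow> 'p \<Rightarrow> real) \<Rightarrow> 'p \<times> 'p \<Rightarrow> ennreal" where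
  "dist_norm d = (\<lambda>(x, y). ennreal (d x y))"

lemma (in Metric_space) normed_category_indiscrete:
  "normed_category (indiscrete_cat M) (dist_norm d)"
  by unfold_locales
    (auto simp: indiscrete_cat_def dist_norm_def hom_def triangle simp flip: ennreal_plus
      intro!: ennreal_leI)


section \<open>2-normed categories\<close>

definition wide_subcategory :: "('o, 'm) cat \<Rightarrow> 'm set \<Rightarrow> bool" where
  "wide_subcategory X S \<longleftrightarrow>
     S \<subseteq> Mor X \<and>
     (\<forall>a \<in> Obj X. Id X a \<in> S) \<and>
     (\<forall>f \<in> S. \<forall>g \<in> S. Cod X f = Dom X g \<longrightarrow> Cmp X g f \<in> S)"

definition subcat :: "('o, 'm) cat \<Rightarrow> 'm set \<Rightarrow> ('o, 'm) cat" where
  "subcat X S = X\<lparr>Mor := S\<rparr>"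

lemma category_subcat:
  assumes "category X" "wide_subcategory X S"
  shows "category (subcat X S)"
proof -
  interpret category X by fact
  have S: "S \<subseteq> Mor X" and I: "\<And>a. a \<in> Obj X \<Longrightarrow> Id X a \<in> S"
    and C: "\<And>f g. f \<in> S \<Longrightarrow> g \<in> S \<Longrightarrow> Cod X f = Dom X g \<Longrightarrow> Cmp X g f \<in> S"
    using assms(2) by (auto simp: wide_subcategory_def)
  have sub: "f \<in> hom (subcat X S) a b \<longleftrightarrow> f \<in> S \<and> f \<in> hom X a b" for f a b
    using S by (auto simp: hom_def subcat_def)
  have [simp]: "Obj (subcat X S) = Obj X" "Mor (subcat X S) = S" "Dom (subcat X S) = Dom X"
    "Cod (subcat X S) = Cod X" "Id (subcat X S) = Id X" "Cmp (subcat X S) = Cmp X"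
    by (simp_all add: subcat_def)
  show ?thesis
  proof
    fix f assume "f \<in> Mor (subcat X S)"
    with S show "Dom (subcat X S) f \<in> Obj (subcat X S)" "Cod (subcat X S) f \<in> Obj (subcat X S)"
      by (auto intro: Dom_Obj Cod_Obj)
  next
    fix f g a b c assume "f \<in> hom (subcat X S) a b" "g \<in> hom (subcat X S) b c"
    then show "Cmp (subcat X S) g f \<in> hom (subcat X S) a c"
      unfolding sub using Cmp_hom[of f a b g c] C[of f g] by (simp add: hom_def)
  qed (auto simp: sub I Id_hom Id_left Id_right intro: assoc)
qed

definition condition_S :: "('o, 'm) cat \<Rightarrow> 'm set \<Rightarrow> bool" where
  "condition_S X S \<longleftrightarrow>
     (\<forall>h \<in> Mor X. \<forall>f \<in> Mor X. Cod X h = Dom X f \<longrightarrow> Cmp X f h \<in> S \<longrightarrow> h \<in> S \<longrightarrow> f \<in> S)"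

definition Cauchy_seq2 :: "'m set \<Rightarrow> (nat \<Rightarrow> nat \<Rightarrow> 'm) \<Rightarrow> bool" where
  "Cauchy_seq2 S s \<longleftrightarrow> (\<exists>N. \<forall>m n. N \<le> m \<longrightarrow> m \<le> n \<longrightarrow> s m n \<in> S)"

definition is_normed_colimit2 ::
  "('o, 'm) cat \<Rightarrow> 'm set \<Rightarrow> (nat \<Rightarrow> 'o) \<Rightarrow> (nat \<Rightarrow> nat \<Rightarrow> 'm) \<Rightarrow> 'o \<Rightarrow> (nat \<Rightarrow> 'm) \<Rightarrow> bool" where
  "is_normed_colimit2 X S x s c \<gamma> \<longleftrightarrow>
     is_colimit X x s c \<gamma> \<and>
     (\<forall>f \<in> Mor X. Dom X f = c \<longrightarrow> (f \<in> S \<longleftrightarrow> (\<exists>N. \<forall>n \<ge> N. Cmp X f (\<gamma> n) \<in> S)))"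

definition Cauchy_cocomplete2 :: "('o, 'm) cat \<Rightarrow> 'm set \<Rightarrow> bool" where
  "Cauchy_cocomplete2 X S \<longleftrightarrow>
     (\<forall>x s. is_sequence X x s \<and> Cauchy_seq2 S s \<longrightarrow> (\<exists>c \<gamma>. is_normed_colimit2 X S x s c \<gamma>))"

text \<open>The sequences lie in \<open>S\<close>; their colimits are taken in \<open>X\<close>, and the cocones need not lie in \<open>S\<close>.\<close>

definition has_colimits_of_sequences_in :: "('o, 'm) cat \<Rightarrow> 'm set \<Rightarrow> bool" where
  "has_colimits_of_sequences_in X S \<longleftrightarrow>
     (\<forall>x s. is_sequence (subcat X S) x s \<longrightarrow> (\<exists>c \<gamma>. is_colimit X x s c \<gamma>))"

text \<open>
  That the category \<open>S\<close> has colimits of sequences has to be read relative to \<open>X\<close>, i.e. together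
  with the following condition. Mere existence of colimits in \<open>S\<close> does not imply Cauchy
  cocompleteness: let \<open>X\<close> be the ordinal \<open>\<omega> + 2\<close>, i.e. the chain \<open>0 < 1 < 2 < \<dots> < u < v\<close>, and let
  \<open>S\<close> consist of the identities and of all \<open>m \<rightarrow> n\<close> and \<open>m \<rightarrow> v\<close> with \<open>m, n < u\<close>. Then \<open>S\<close> satisfies
  Condition (S) and both \<open>X\<close> and \<open>S\<close> have all colimits of sequences, but the Cauchy sequence
  \<open>0 \<rightarrow> 1 \<rightarrow> 2 \<rightarrow> \<dots>\<close> has colimit \<open>u\<close> in \<open>X\<close> and \<open>v\<close> in \<open>S\<close>; since \<open>1\<^sub>u\<close> lies in \<open>S\<close> and no \<open>n \<rightarrow> u\<close>
  does, it has no normed colimit. Conversely, Cauchy cocompleteness does imply the condition.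
\<close>

definition inclusion_preserves_sequential_colimits :: "('o, 'm) cat \<Rightarrow> 'm set \<Rightarrow> bool" where
  "inclusion_preserves_sequential_colimits X S \<longleftrightarrow>
     (\<forall>x s c \<gamma>. is_sequence (subcat X S) x s \<longrightarrow> is_colimit (subcat X S) x s c \<gamma>
        \<longrightarrow> is_colimit X x s c \<gamma>)"

end

theory Submission
  imports Defs
begin

text \<open>
  (1) In \<open>iX\<close> every object is a colimit of every sequence. The norm condition on a colimit \<open>c\<close> says
  that \<open>d c y\<close> is the limit superior of \<open>d (x n) y\<close> for all \<open>y\<close>. It holds if \<open>x\<close> converges to \<open>c\<close>,
  and its instance \<open>y = c\<close> forces that convergence.

  (2) A Cauchy sequence lies in \<open>S\<close> from some index on, and dropping finitely many terms does not
  change colimits. For a colimit cocone in \<open>S\<close>, Condition (S) is what makes it a normed colimit.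
  Conversely, the norm condition at the identity puts the cocone of a normed colimit into \<open>S\<close>, and
  at the other morphisms it makes this cocone universal in \<open>S\<close>. Every colimit in \<open>S\<close> is isomorphic
  to that one, hence is also a colimit in \<open>X\<close>.
\<close>

section \<open>Metric spaces\<close>

text \<open>An infimum in \<open>ennreal\<close> vanishes exactly when it lies below every positive
  \<open>e\<close>, and an infimum lies below \<open>e\<close> exactly when some member does. This
  replaces the INF-SUP form by one that can be compared with \<open>MCauchy\<close>.\<close>

lemma Cauchy_seq_iff:
  "Cauchy_seq nrm s \<longleftrightarrow> (\<forall>e>0. \<exists>N. \<forall>m n. N \<le> m \<longrightarrow> m \<le> n \<longrightarrow> nrm (s m n) < e)"
proof -
  let ?S = "\<lambda>N. SUP (m, n) \<in> {(m, n). N \<le> m \<and> m \<le> n}. nrm (s m n)"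
  have "Cauchy_seq nrm s \<longleftrightarrow> (\<forall>e>0. \<exists>N. ?S N < e)"
  proof -
    have "Cauchy_seq nrm s \<longleftrightarrow> \<not> 0 < (INF N. ?S N)"
      by (simp add: Cauchy_seq_def)
    also have "\<dots> \<longleftrightarrow> (\<forall>e>0. (INF N. ?S N) < e)"
      using not_gr_zero by force
    finally show ?thesis
      by (simp add: INF_less_iff)
  qed
  also have "\<dots> \<longleftrightarrow> (\<forall>e>0. \<exists>N. \<forall>m n. N \<le> m \<longrightarrow> m \<le> n \<longrightarrow> nrm (s m n) < e)"
    (is "?L \<longleftrightarrow> ?R")
  proof
    assume L: ?L
    show ?R
    proof (intro allI impI)
      fix e :: ennreal assume "e > 0"
      with L obtain N where N: "?S N < e" by blast
      have "nrm (s m n) < e" if "N \<le> m" "m \<le> n" for m n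
        by (rule le_less_trans[OF _ N], rule SUP_upper2[of "(m, n)"]) (use that in auto)
      then show "\<exists>N. \<forall>m n. N \<le> m \<longrightarrow> m \<le> n \<longrightarrow> nrm (s m n) < e" by blast
    qed
  next
    assume R: ?R
    show ?L
    proof (intro allI impI)
      fix e :: ennreal assume "e > 0"
      \<comment> \<open>A supremum of values below \<open>e\<close> may be \<open>e\<close> itself;
        bounding the terms by a smaller \<open>e'\<close> keeps the final inequality strict.\<close>
      then obtain e' where e': "0 < e'" "e' < e" using dense by blast
      with R obtain N where "\<forall>m n. N \<le> m \<longrightarrow> m \<le> n \<longrightarrow> nrm (s m n) < e'" by blast
      then have "?S N \<le> e'"
        by (intro SUP_least) (auto intro: less_imp_le)
      with e' show "\<exists>N. ?S N < e" using le_less_trans by blast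
    qed
  qed
  finally show ?thesis .
qed

text \<open>Each hom-set between points of \<open>M\<close> is a singleton, so the points determine
  all transition morphisms and functoriality is automatic.\<close>

lemma is_sequence_indiscrete_iff:
  "is_sequence (indiscrete_cat M) x s \<longleftrightarrow> range x \<subseteq> M \<and> (\<forall>m n. m \<le> n \<longrightarrow> s m n = (x m, x n))"
proof
  assume s: "is_sequence (indiscrete_cat M) x s"
  have "x n \<in> M" for n
    using s by (simp add: is_sequence_def indiscrete_cat_def)
  moreover have "s m n = (x m, x n)" if "m \<le> n" for m n
  proof -
    have "s m n \<in> hom (indiscrete_cat M) (x m) (x n)"
      using s that unfolding is_sequence_def by blast
    then show ?thesis by (simp add: hom_def indiscrete_cat_def prod_eq_iff)
  qed
  ultimately show "range x \<subseteq> M \<and> (\<forall>m n. m \<le> n \<longrightarrow> s m n = (x m, x n))" by blast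
next
  assume "range x \<subseteq> M \<and> (\<forall>m n. m \<le> n \<longrightarrow> s m n = (x m, x n))"
  then show "is_sequence (indiscrete_cat M) x s"
    by (auto simp: is_sequence_def indiscrete_cat_def hom_def)
qed

text \<open>Every cocone is universal, because \<open>(c, y)\<close> is the only morphism from
  \<open>c\<close> to \<open>y\<close>. Compatibility of a cocone reduces to the condition on
  \<open>fst (s m n)\<close>, since a composite keeps the source of its first factor and the target
  of its second; for a sequence this condition holds by itself.\<close>

lemma is_colimit_indiscrete_iff:
  assumes "range x \<subseteq> M"
  shows "is_colimit (indiscrete_cat M) x s c \<gamma> \<longleftrightarrow>
    c \<in> M \<and> (\<forall>n. \<gamma> n = (x n, c)) \<and> (\<forall>m n. m \<le> n \<longrightarrow> fst (s m n) = x m)"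
proof -
  have cocone: "is_cocone (indiscrete_cat M) x s c \<gamma> \<longleftrightarrow>
      c \<in> M \<and> (\<forall>n. \<gamma> n = (x n, c)) \<and> (\<forall>m n. m \<le> n \<longrightarrow> fst (s m n) = x m)" for c \<gamma>
    using assms by (fastforce simp: is_cocone_def indiscrete_cat_def hom_def prod_eq_iff mem_Times_iff)
  have univ: "\<exists>!f. f \<in> hom (indiscrete_cat M) c y \<and> (\<forall>n. Cmp (indiscrete_cat M) f (\<gamma> n) = \<delta> n)"
    if "c \<in> M" "\<forall>n. \<gamma> n = (x n, c)" "y \<in> M" "\<forall>n. \<delta> n = (x n, y)" for y \<delta>
    using that by (intro ex1I[of _ "(c, y)"]) (auto simp: indiscrete_cat_def hom_def)
  show ?thesis
    unfolding is_colimit_def cocone by (rule iffI, blast) (intro conjI allI impI univ; blast)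
qed

context Metric_space
begin

lemma Cauchy_seq_indiscrete_iff:
  assumes "is_sequence (indiscrete_cat M) x s"
  shows "Cauchy_seq (dist_norm d) s \<longleftrightarrow> MCauchy x"
proof -
  have x: "range x \<subseteq> M" and s: "\<And>m n. m \<le> n \<Longrightarrow> s m n = (x m, x n)"
    using assms by (auto simp: is_sequence_indiscrete_iff)
  show ?thesis
  proof
    assume C: "Cauchy_seq (dist_norm d) s"
    show "MCauchy x"
      unfolding MCauchy_def
    proof (intro conjI allI impI x)
      fix e :: real assume "e > 0"
      then have "ennreal e > 0" by simp
      with C obtain N where N: "\<And>m n. N \<le> m \<Longrightarrow> m \<le> n \<Longrightarrow> dist_norm d (s m n) < ennreal e"
        unfolding Cauchy_seq_iff by blast
      have le: "d (x m) (x n) < e" if "N \<le> m" "m \<le> n" for m n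
        using N[OF that] that \<open>e > 0\<close> by (simp add: s dist_norm_def ennreal_less_iff)
      \<comment> \<open>The norm only controls pairs with \<open>m \<le> n\<close>; symmetry of
        \<open>d\<close> supplies the other order.\<close>
      have "d (x m) (x n) < e" if "N \<le> m" "N \<le> n" for m n
        using le[of m n] le[of n m] that commute[of "x m" "x n"] by (cases "m \<le> n") auto
      then show "\<exists>N. \<forall>n n'. N \<le> n \<longrightarrow> N \<le> n' \<longrightarrow> d (x n) (x n') < e" by blast
    qed
  next
    assume C: "MCauchy x"
    show "Cauchy_seq (dist_norm d) s"
      unfolding Cauchy_seq_iff
    proof (intro allI impI)
      fix e :: ennreal assume "e > 0"
      \<comment> \<open>The bound \<open>e\<close> may be infinite. Anything strictly below it is
        finite, hence given by a positive real \<open>r\<close> to which \<open>MCauchy\<close>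
        applies.\<close>
      then obtain e' where e': "0 < e'" "e' < e" using dense by blast
      then have "e' < top" using less_le_trans top_greatest by blast
      then obtain r where "e' = ennreal r" using less_top_ennreal by blast
      with e' have r: "r > 0" "ennreal r < e" by simp_all
      from C r(1) obtain N where N: "\<And>m n. N \<le> m \<Longrightarrow> N \<le> n \<Longrightarrow> d (x m) (x n) < r"
        unfolding MCauchy_def by blast
      have "dist_norm d (s m n) < e" if "N \<le> m" "m \<le> n" for m n
      proof -
        have "dist_norm d (s m n) = ennreal (d (x m) (x n))"
          using that by (simp add: s dist_norm_def)
        also have "\<dots> \<le> ennreal r"
          using N[of m n] that by (intro ennreal_leI) auto
        finally show ?thesis using r(2) by simp
      qed
      then show "\<exists>N. \<forall>m n. N \<le> m \<longrightarrow> m \<le> n \<longrightarrow> dist_norm d (s m n) < e" by blast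
    qed
  qed
qed

text \<open>Once the legs are the morphisms \<open>(x n, c)\<close>, only the norm condition is
  left. A morphism out of \<open>c\<close> is a pair \<open>(c, y)\<close>, its composite with the
  leg is \<open>(x n, y)\<close>, and the infimum of the suprema over tails is a limit
  superior.\<close>

lemma is_normed_colimit_indiscrete_iff:
  assumes "is_sequence (indiscrete_cat M) x s"
  shows "is_normed_colimit (indiscrete_cat M) (dist_norm d) x s c \<gamma> \<longleftrightarrow>
    c \<in> M \<and> (\<forall>n. \<gamma> n = (x n, c)) \<and>
    (\<forall>y\<in>M. ennreal (d c y) = limsup (\<lambda>n. ennreal (d (x n) y)))"
proof -
  have x: "range x \<subseteq> M" and s: "\<And>m n. m \<le> n \<Longrightarrow> s m n = (x m, x n)"
    using assms by (auto simp: is_sequence_indiscrete_iff)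
  have "is_colimit (indiscrete_cat M) x s c \<gamma> \<longleftrightarrow> c \<in> M \<and> (\<forall>n. \<gamma> n = (x n, c))"
    using s by (auto simp: is_colimit_indiscrete_iff[OF x])
  then show ?thesis
    unfolding is_normed_colimit_def
    by (auto simp: indiscrete_cat_def dist_norm_def limsup_INF_SUP)
qed

lemma limitin_iff_limsup_dist:
  assumes x: "range x \<subseteq> M" and c: "c \<in> M"
  shows "limitin mtopology x c sequentially \<longleftrightarrow>
    (\<forall>y\<in>M. ennreal (d c y) = limsup (\<lambda>n. ennreal (d (x n) y)))"
proof
  assume L: "limitin mtopology x c sequentially"
  show "\<forall>y\<in>M. ennreal (d c y) = limsup (\<lambda>n. ennreal (d (x n) y))"
  proof
    fix y assume y: "y \<in> M"
    have *: "(\<lambda>n. d (x n) c) \<longlonglongrightarrow> 0"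
      using L by (simp add: limitin_metric_dist_null)
    \<comment> \<open>Two triangle inequalities: the distance to \<open>y\<close> is a 1-Lipschitz
      function.\<close>
    have "\<bar>d (x n) y - d c y\<bar> \<le> d (x n) c" for n
      using range_subsetD[OF x, of n] c y triangle[of "x n" c y] triangle[of c "x n" y]
        commute[of c "x n"] by auto
    then have "(\<lambda>n. d (x n) y - d c y) \<longlonglongrightarrow> 0"
      by (intro Lim_null_comparison[OF _ *]) auto
    then have "(\<lambda>n. d (x n) y) \<longlonglongrightarrow> d c y"
      using Lim_null by blast
    then have "(\<lambda>n. ennreal (d (x n) y)) \<longlonglongrightarrow> ennreal (d c y)"
      by (rule tendsto_ennrealI)
    then show "ennreal (d c y) = limsup (\<lambda>n. ennreal (d (x n) y))"
      by (rule lim_imp_Limsup[OF sequentially_bot, symmetric])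
  qed
next
  assume "\<forall>y\<in>M. ennreal (d c y) = limsup (\<lambda>n. ennreal (d (x n) y))"
  with c have "limsup (\<lambda>n. ennreal (d (x n) c)) = ennreal 0"
    by (metis mdist_zero)
  \<comment> \<open>For values in \<open>ennreal\<close>, a limit superior of 0 already forces
    convergence to 0.\<close>
  then have "(\<lambda>n. ennreal (d (x n) c)) \<longlonglongrightarrow> ennreal 0"
    by (simp add: tendsto_0_if_Limsup_eq_0_ennreal)
  then have "(\<lambda>n. d (x n) c) \<longlonglongrightarrow> 0"
    by (subst (asm) tendsto_ennreal_iff) auto
  moreover have "x n \<in> M" for n using x by blast
  ultimately show "limitin mtopology x c sequentially"
    using c by (simp add: limitin_metric_dist_null)
qed

theorem Cauchy_cocomplete_indiscrete_iff:
  "Cauchy_cocomplete (indiscrete_cat M) (dist_norm d) \<longleftrightarrow> mcomplete"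
proof
  assume CC: "Cauchy_cocomplete (indiscrete_cat M) (dist_norm d)"
  show mcomplete
    unfolding mcomplete_def
  proof (intro allI impI)
    fix x assume C: "MCauchy x"
    \<comment> \<open>For \<open>m \<le> n\<close> this choice is forced; the other values are
      irrelevant.\<close>
    define s where "s m n = (x m, x n)" for m n
    have x: "range x \<subseteq> M" using C by (simp add: MCauchy_def)
    then have s: "is_sequence (indiscrete_cat M) x s"
      by (simp add: is_sequence_indiscrete_iff s_def)
    with CC C obtain c \<gamma> where "is_normed_colimit (indiscrete_cat M) (dist_norm d) x s c \<gamma>"
      unfolding Cauchy_cocomplete_def Cauchy_seq_indiscrete_iff[OF s, symmetric] by blast
    then show "\<exists>c. limitin mtopology x c sequentially"
      unfolding is_normed_colimit_indiscrete_iff[OF s]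
      using limitin_iff_limsup_dist[OF x, of c] by blast
  qed
next
  assume mcomplete
  show "Cauchy_cocomplete (indiscrete_cat M) (dist_norm d)"
    unfolding Cauchy_cocomplete_def
  proof (intro allI impI, elim conjE)
    fix x s assume s: "is_sequence (indiscrete_cat M) x s" and C: "Cauchy_seq (dist_norm d) s"
    have x: "range x \<subseteq> M" using s by (simp add: is_sequence_indiscrete_iff)
    have "MCauchy x" using C Cauchy_seq_indiscrete_iff[OF s] by blast
    with \<open>mcomplete\<close> obtain c where c: "limitin mtopology x c sequentially"
      unfolding mcomplete_def by blast
    then have "c \<in> M" by (simp add: limitin_metric)
    with c have "is_normed_colimit (indiscrete_cat M) (dist_norm d) x s c (\<lambda>n. (x n, c))"
      unfolding is_normed_colimit_indiscrete_iff[OF s]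
      using limitin_iff_limsup_dist[OF x, of c] by simp
    then show "\<exists>c \<gamma>. is_normed_colimit (indiscrete_cat M) (dist_norm d) x s c \<gamma>" by blast
  qed
qed

end

section \<open>Colimits of sequences\<close>

lemma is_sequenceD:
  assumes "is_sequence X x s"
  shows "x n \<in> Obj X" "m \<le> n \<Longrightarrow> s m n \<in> hom X (x m) (x n)" "s n n = Id X (x n)"
    "k \<le> m \<Longrightarrow> m \<le> n \<Longrightarrow> Cmp X (s m n) (s k m) = s k n"
  using assms unfolding is_sequence_def by (blast, blast, blast, metis)

lemma is_coconeD:
  assumes "is_cocone X x s c \<gamma>"
  shows "c \<in> Obj X" "\<gamma> n \<in> hom X (x n) c" "m \<le> n \<Longrightarrow> Cmp X (\<gamma> n) (s m n) = \<gamma> m"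
  using assms by (auto simp: is_cocone_def)

lemma is_colimit_cocone: "is_colimit X x s c \<gamma> \<Longrightarrow> is_cocone X x s c \<gamma>"
  by (simp add: is_colimit_def)

lemma is_colimit_factor:
  assumes "is_colimit X x s c \<gamma>" "is_cocone X x s y \<delta>"
  obtains f where "f \<in> hom X c y" "\<And>n. Cmp X f (\<gamma> n) = \<delta> n"
  using assms unfolding is_colimit_def by blast

section \<open>Joint epicness, uniqueness and transport of colimits\<close>

context category
begin

lemma is_cocone_Cmp:
  assumes "is_sequence X x s" "is_cocone X x s c \<gamma>" "f \<in> hom X c y"
  shows "is_cocone X x s y (\<lambda>n. Cmp X f (\<gamma> n))"
  unfolding is_cocone_def
proof (intro conjI allI impI)
  show "y \<in> Obj X" using assms(3) Cod_Obj by (auto simp: hom_def)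
  show "Cmp X f (\<gamma> n) \<in> hom X (x n) y" for n
    using Cmp_hom is_coconeD(2)[OF assms(2)] assms(3) by blast
  show "Cmp X (Cmp X f (\<gamma> n)) (s m n) = Cmp X f (\<gamma> m)" if "m \<le> n" for m n
    using assoc[OF is_sequenceD(2)[OF assms(1) that] is_coconeD(2)[OF assms(2)] assms(3)]
      is_coconeD(3)[OF assms(2) that] by simp
qed

text \<open>A colimit cocone is jointly epic: \<open>f\<close> and \<open>g\<close> both mediate to
  the cocone with legs \<open>Cmp X g (\<gamma> n)\<close>, and the mediating morphism is
  unique.\<close>

lemma is_colimit_cancel:
  assumes s: "is_sequence X x s" and c: "is_colimit X x s c \<gamma>"
    and fg: "f \<in> hom X c y" "g \<in> hom X c y" and eq: "\<And>n. Cmp X f (\<gamma> n) = Cmp X g (\<gamma> n)"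
  shows "f = g"
proof -
  have "\<exists>!h. h \<in> hom X c y \<and> (\<forall>n. Cmp X h (\<gamma> n) = Cmp X g (\<gamma> n))"
    using c is_cocone_Cmp[OF s is_colimit_cocone[OF c] fg(2)] unfolding is_colimit_def by blast
  with fg eq show ?thesis by blast
qed

text \<open>The mediating morphisms in the two directions are mutually inverse, since both
  composites agree with an identity on the legs of a jointly epic cocone. In
  \<open>subcat X S\<close> this yields an isomorphism whose two directions lie in
  \<open>S\<close>.\<close>

lemma is_colimit_unique:
  assumes s: "is_sequence X x s" and c: "is_colimit X x s c \<gamma>" and c': "is_colimit X x s c' \<gamma>'"
  obtains u v where "u \<in> hom X c c'" "v \<in> hom X c' c" "Cmp X v u = Id X c" "Cmp X u v = Id X c'"
    "\<And>n. Cmp X u (\<gamma> n) = \<gamma>' n" "\<And>n. Cmp X v (\<gamma>' n) = \<gamma> n"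
proof -
  note k = is_colimit_cocone[OF c] and k' = is_colimit_cocone[OF c']
  note h = is_coconeD(2)[OF k] and h' = is_coconeD(2)[OF k']
  obtain u where u: "u \<in> hom X c c'" "\<And>n. Cmp X u (\<gamma> n) = \<gamma>' n"
    using is_colimit_factor[OF c k'] by blast
  obtain v where v: "v \<in> hom X c' c" "\<And>n. Cmp X v (\<gamma>' n) = \<gamma> n"
    using is_colimit_factor[OF c' k] by blast
  have "Cmp X v u = Id X c"
    using is_colimit_cancel[OF s c Cmp_hom[OF u(1) v(1)] Id_hom[OF is_coconeD(1)[OF k]]]
      assoc[OF h u(1) v(1)] Id_left[OF h] u(2) v(2) by simp
  moreover have "Cmp X u v = Id X c'"
    using is_colimit_cancel[OF s c' Cmp_hom[OF v(1) u(1)] Id_hom[OF is_coconeD(1)[OF k']]]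
      assoc[OF h' v(1) u(1)] Id_left[OF h'] u(2) v(2) by simp
  ultimately show thesis using that u v by blast
qed

text \<open>A mediating morphism out of \<open>c'\<close> is one out of \<open>c\<close> preceded by
  \<open>v\<close>. For uniqueness, \<open>g \<cdot> u\<close> is determined by the universal
  property of \<open>c\<close>, and \<open>g\<close> is recovered as
  \<open>(g \<cdot> u) \<cdot> v\<close>.\<close>

lemma is_colimit_transport:
  assumes s: "is_sequence X x s" and c: "is_colimit X x s c \<gamma>" and k': "is_cocone X x s c' \<gamma>'"
    and u: "u \<in> hom X c c'" and v: "v \<in> hom X c' c"
    and uv: "Cmp X u v = Id X c'"
    and u\<gamma>: "\<And>n. Cmp X u (\<gamma> n) = \<gamma>' n" and v\<gamma>: "\<And>n. Cmp X v (\<gamma>' n) = \<gamma> n"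
  shows "is_colimit X x s c' \<gamma>'"
  unfolding is_colimit_def
proof (intro conjI allI impI k')
  note h = is_coconeD(2)[OF is_colimit_cocone[OF c]] and h' = is_coconeD(2)[OF k']
  fix y \<delta> assume "is_cocone X x s y \<delta>"
  then obtain f where f: "f \<in> hom X c y" "\<And>n. Cmp X f (\<gamma> n) = \<delta> n"
    using is_colimit_factor[OF c] by blast
  show "\<exists>!f. f \<in> hom X c' y \<and> (\<forall>n. Cmp X f (\<gamma>' n) = \<delta> n)"
  proof (rule ex1I[of _ "Cmp X f v"])
    show "Cmp X f v \<in> hom X c' y \<and> (\<forall>n. Cmp X (Cmp X f v) (\<gamma>' n) = \<delta> n)"
      using Cmp_hom[OF v f(1)] assoc[OF h' v f(1)] v\<gamma> f(2) by simp
  next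
    fix g assume g: "g \<in> hom X c' y \<and> (\<forall>n. Cmp X g (\<gamma>' n) = \<delta> n)"
    then have "Cmp X (Cmp X g u) (\<gamma> n) = \<delta> n" for n
      using assoc[OF h u] u\<gamma> by (metis (no_types))
    then have "Cmp X g u = f"
      using is_colimit_cancel[OF s c] Cmp_hom[OF u] f g by metis
    then show "g = Cmp X f v"
      using assoc[OF v u] g uv Id_right by metis
  qed
qed

section \<open>Dropping finitely many terms of a sequence\<close>

lemma is_sequence_shift:
  "is_sequence X x s \<Longrightarrow> is_sequence X (\<lambda>n. x (n + N)) (\<lambda>m n. s (m + N) (n + N))"
  unfolding is_sequence_def by (meson add_le_cancel_right)

text \<open>A tail is cofinal. The leg at \<open>n\<close> first moves \<open>N\<close> steps along
  the sequence, into the tail, and then follows the given cocone; this also defines the legs at the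
  dropped indices.\<close>

lemma is_colimit_unshift:
  assumes s: "is_sequence X x s"
    and c: "is_colimit X (\<lambda>n. x (n + N)) (\<lambda>m n. s (m + N) (n + N)) c \<gamma>"
  defines "\<gamma>' \<equiv> \<lambda>n. Cmp X (\<gamma> n) (s n (n + N))"
  shows "is_colimit X x s c \<gamma>'" and "\<And>n. \<gamma>' (n + N) = \<gamma> n"
proof -
  note k = is_colimit_cocone[OF c]
  have h: "\<gamma> n \<in> hom X (x (n + N)) c" for n using is_coconeD(2)[OF k] .
  have hs: "s m n \<in> hom X (x m) (x n)" if "m \<le> n" for m n using is_sequenceD(2)[OF s that] .
  \<comment> \<open>In the tail, the transition inside \<open>\<gamma>' (n + N)\<close> runs from
    \<open>n\<close> to \<open>n + N\<close>, so the cocone condition absorbs it.\<close>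
  show shift: "\<gamma>' (n + N) = \<gamma> n" for n
    using is_coconeD(3)[OF k, of n "n + N"] by (simp add: \<gamma>'_def)
  have k': "is_cocone X x s c \<gamma>'"
    unfolding is_cocone_def
  proof (intro conjI allI impI is_coconeD(1)[OF k])
    show "\<gamma>' n \<in> hom X (x n) c" for n
      unfolding \<gamma>'_def by (rule Cmp_hom[OF hs h]) simp
    show "Cmp X (\<gamma>' n) (s m n) = \<gamma>' m" if mn: "m \<le> n" for m n
    proof -
      have "Cmp X (\<gamma>' n) (s m n) = Cmp X (\<gamma> n) (Cmp X (s n (n + N)) (s m n))"
        unfolding \<gamma>'_def using assoc[OF hs[OF mn] hs h, of "n"] by simp
      \<comment> \<open>By functoriality both inner composites are
        \<open>s m (n + N)\<close>.\<close>
      also have "\<dots> = Cmp X (\<gamma> n) (Cmp X (s (m + N) (n + N)) (s m (m + N)))"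
        using is_sequenceD(4)[OF s] mn by simp
      also have "\<dots> = Cmp X (Cmp X (\<gamma> n) (s (m + N) (n + N))) (s m (m + N))"
        using assoc[OF hs hs h, of m "m + N" n] mn by simp
      also have "\<dots> = \<gamma>' m"
        using is_coconeD(3)[OF k mn] by (simp add: \<gamma>'_def)
      finally show ?thesis .
    qed
  qed
  show "is_colimit X x s c \<gamma>'"
    unfolding is_colimit_def
  proof (intro conjI allI impI k')
    fix y \<delta> assume d: "is_cocone X x s y \<delta>"
    then have d': "is_cocone X (\<lambda>n. x (n + N)) (\<lambda>m n. s (m + N) (n + N)) y (\<lambda>n. \<delta> (n + N))"
      by (simp add: is_cocone_def)
    then obtain f where f: "f \<in> hom X c y" "\<And>n. Cmp X f (\<gamma> n) = \<delta> (n + N)"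
      using is_colimit_factor[OF c] by blast
    show "\<exists>!f. f \<in> hom X c y \<and> (\<forall>n. Cmp X f (\<gamma>' n) = \<delta> n)"
    proof (rule ex1I[of _ f])
      show "f \<in> hom X c y \<and> (\<forall>n. Cmp X f (\<gamma>' n) = \<delta> n)"
        using f assoc[OF hs h f(1)] is_coconeD(3)[OF d] by (simp add: \<gamma>'_def)
    next
      fix g assume g: "g \<in> hom X c y \<and> (\<forall>n. Cmp X g (\<gamma>' n) = \<delta> n)"
      \<comment> \<open>The indices \<open>n + N\<close> suffice for uniqueness, because the legs
        there are those of the tail.\<close>
      then have "Cmp X g (\<gamma> n) = \<delta> (n + N)" for n by (metis shift)
      with f g show "g = f"
        using is_colimit_cancel[OF is_sequence_shift[OF s] c] by metis
    qed
  qed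
qed

end

section \<open>Wide subcategories\<close>

locale category_with_wide_subcategory = category X
  for X :: "('o, 'm) cat" +
  fixes S :: "'m set"
  assumes wide: "wide_subcategory X S"
begin

lemma S_Mor: "f \<in> S \<Longrightarrow> f \<in> Mor X"
  and S_Id: "a \<in> Obj X \<Longrightarrow> Id X a \<in> S"
  and S_Cmp: "f \<in> S \<Longrightarrow> g \<in> S \<Longrightarrow> f \<in> hom X a b \<Longrightarrow> g \<in> hom X b c \<Longrightarrow> Cmp X g f \<in> S"
  using wide by (auto simp: wide_subcategory_def hom_def)

section \<open>The wide subcategory as a category in its own right\<close>

lemma subcat_sel:
  "Obj (subcat X S) = Obj X" "Id (subcat X S) = Id X" "Cmp (subcat X S) = Cmp X"
  by (simp_all add: subcat_def)

lemma hom_subcat_iff: "f \<in> hom (subcat X S) a b \<longleftrightarrow> f \<in> S \<and> f \<in> hom X a b"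
  using S_Mor by (auto simp: hom_def subcat_def)

lemma is_sequence_subcat_iff:
  "is_sequence (subcat X S) x s \<longleftrightarrow> is_sequence X x s \<and> (\<forall>m n. m \<le> n \<longrightarrow> s m n \<in> S)"
  unfolding is_sequence_def subcat_sel hom_subcat_iff by blast

lemma is_cocone_subcat_iff:
  "is_cocone (subcat X S) x s c \<gamma> \<longleftrightarrow> is_cocone X x s c \<gamma> \<and> (\<forall>n. \<gamma> n \<in> S)"
  unfolding is_cocone_def subcat_sel hom_subcat_iff by blast

sublocale subcat: category "subcat X S"
  by (rule category_subcat[OF category_axioms wide])

text \<open>Since the identity of \<open>c\<close> lies in \<open>S\<close>, the norm condition puts
  all late legs into \<open>S\<close>. Any earlier leg is a late one composed with a transition
  morphism, and these lie in \<open>S\<close> as well.\<close>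

lemma normed_colimit2_in_S:
  assumes s: "is_sequence (subcat X S) x s" and c: "is_normed_colimit2 X S x s c \<gamma>"
  shows "\<gamma> n \<in> S"
proof -
  have k: "is_cocone X x s c \<gamma>"
    using c by (simp add: is_normed_colimit2_def is_colimit_cocone)
  have I: "Id X c \<in> hom X c c" "Id X c \<in> S"
    using is_coconeD(1)[OF k] Id_hom S_Id by auto
  then obtain N where "\<forall>n\<ge>N. Cmp X (Id X c) (\<gamma> n) \<in> S"
    using c unfolding is_normed_colimit2_def hom_def by blast
  then have "\<gamma> (max n N) \<in> S"
    using Id_left[OF is_coconeD(2)[OF k, of "max n N"]] by (metis max.cobounded2)
  moreover have "s n (max n N) \<in> S" "s n (max n N) \<in> hom X (x n) (x (max n N))"
    using is_sequenceD(2)[OF s, of n "max n N"] by (simp_all add: hom_subcat_iff)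
  ultimately have "Cmp X (\<gamma> (max n N)) (s n (max n N)) \<in> S"
    using S_Cmp[OF _ _ _ is_coconeD(2)[OF k]] by simp
  then show ?thesis using is_coconeD(3)[OF k, of n "max n N"] by simp
qed

text \<open>The mediating morphism already exists uniquely in \<open>X\<close>. Its composites with
  the legs are the legs \<open>\<delta> n\<close> in \<open>S\<close>, so the norm condition puts it
  into \<open>S\<close>.\<close>

lemma normed_colimit2_imp_colimit_subcat:
  assumes s: "is_sequence (subcat X S) x s" and c: "is_normed_colimit2 X S x s c \<gamma>"
  shows "is_colimit (subcat X S) x s c \<gamma>"
proof -
  have cX: "is_colimit X x s c \<gamma>"
    \<comment> \<open>This is the norm condition from right to left, with threshold 0.\<close>
    and crit: "\<And>f y. f \<in> hom X c y \<Longrightarrow> \<forall>n. Cmp X f (\<gamma> n) \<in> S \<Longrightarrow> f \<in> S"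
    using c by (auto simp: is_normed_colimit2_def hom_def)
  show ?thesis
    unfolding is_colimit_def
  proof (intro conjI allI impI)
    show "is_cocone (subcat X S) x s c \<gamma>"
      using is_colimit_cocone[OF cX] normed_colimit2_in_S[OF s c]
      by (simp add: is_cocone_subcat_iff)
  next
    fix y \<delta> assume "is_cocone (subcat X S) x s y \<delta>"
    then have d: "is_cocone X x s y \<delta>" "\<And>n. \<delta> n \<in> S" by (auto simp: is_cocone_subcat_iff)
    then have "\<exists>!f. f \<in> hom X c y \<and> (\<forall>n. Cmp X f (\<gamma> n) = \<delta> n)"
      using cX unfolding is_colimit_def by blast
    then show "\<exists>!f. f \<in> hom (subcat X S) c y \<and> (\<forall>n. Cmp (subcat X S) f (\<gamma> n) = \<delta> n)"
      using crit d(2) unfolding hom_subcat_iff subcat_sel by metis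
  qed
qed

text \<open>One implication is closure of \<open>S\<close> under composition. For the other, a
  single index beyond both thresholds suffices: there \<open>\<gamma> n\<close> and
  \<open>f \<cdot> \<gamma> n\<close> lie in \<open>S\<close>, and Condition (S) gives
  \<open>f\<close>. The threshold \<open>N\<close> allows for Cauchy sequences whose early legs lie
  outside \<open>S\<close>.\<close>

lemma colimit_imp_normed_colimit2:
  assumes S: "condition_S X S" and c: "is_colimit X x s c \<gamma>" and \<gamma>: "\<And>n. N \<le> n \<Longrightarrow> \<gamma> n \<in> S"
  shows "is_normed_colimit2 X S x s c \<gamma>"
  unfolding is_normed_colimit2_def
proof (intro conjI ballI impI c)
  have h: "\<gamma> n \<in> hom X (x n) c" for n using is_coconeD(2)[OF is_colimit_cocone[OF c]] .
  fix f assume f: "f \<in> Mor X" "Dom X f = c"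
  show "f \<in> S \<longleftrightarrow> (\<exists>N. \<forall>n\<ge>N. Cmp X f (\<gamma> n) \<in> S)"
  proof
    assume "f \<in> S"
    then have "Cmp X f (\<gamma> n) \<in> S" if "N \<le> n" for n
      using S_Cmp[OF \<gamma>[OF that] _ h] f by (auto simp: hom_def)
    then show "\<exists>N. \<forall>n\<ge>N. Cmp X f (\<gamma> n) \<in> S" by blast
  next
    assume "\<exists>N. \<forall>n\<ge>N. Cmp X f (\<gamma> n) \<in> S"
    then obtain N' where "\<forall>n\<ge>N'. Cmp X f (\<gamma> n) \<in> S" by blast
    then have "Cmp X f (\<gamma> (max N N')) \<in> S" "\<gamma> (max N N') \<in> S" using \<gamma> by auto
    then show "f \<in> S" using S f h[of "max N N'"] unfolding condition_S_def hom_def by auto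
  qed
qed

section \<open>Cauchy cocompleteness and colimits in the wide subcategory\<close>

lemma sequence_subcat_normed_colimit2:
  assumes "Cauchy_cocomplete2 X S" "is_sequence (subcat X S) x s"
  obtains c \<gamma> where "is_normed_colimit2 X S x s c \<gamma>"
proof -
  have "is_sequence X x s" "Cauchy_seq2 S s"
    using assms(2) by (auto simp: is_sequence_subcat_iff Cauchy_seq2_def)
  with assms(1) that show thesis unfolding Cauchy_cocomplete2_def by blast
qed

lemma Cauchy_cocomplete2_imp_preserves:
  assumes CC: "Cauchy_cocomplete2 X S"
  shows "inclusion_preserves_sequential_colimits X S"
  unfolding inclusion_preserves_sequential_colimits_def
proof (intro allI impI)
  fix x s c' \<gamma>'
  assume s: "is_sequence (subcat X S) x s" and c': "is_colimit (subcat X S) x s c' \<gamma>'"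
  obtain c \<gamma> where c: "is_normed_colimit2 X S x s c \<gamma>"
    using sequence_subcat_normed_colimit2[OF CC s] .
  \<comment> \<open>Uniqueness is applied inside \<open>subcat X S\<close>. The resulting
    isomorphism is then read in \<open>X\<close>, which has the same composition and identities, and
    carries the colimit property from \<open>c\<close> to \<open>c'\<close>.\<close>
  obtain u v where "u \<in> hom (subcat X S) c c'" "v \<in> hom (subcat X S) c' c"
    "Cmp (subcat X S) v u = Id (subcat X S) c" "Cmp (subcat X S) u v = Id (subcat X S) c'"
    "\<And>n. Cmp (subcat X S) u (\<gamma> n) = \<gamma>' n" "\<And>n. Cmp (subcat X S) v (\<gamma>' n) = \<gamma> n"
    by (rule subcat.is_colimit_unique[OF s normed_colimit2_imp_colimit_subcat[OF s c] c']) blast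
  moreover have "is_sequence X x s" "is_colimit X x s c \<gamma>" "is_cocone X x s c' \<gamma>'"
    using s c is_colimit_cocone[OF c']
    by (auto simp: is_sequence_subcat_iff is_normed_colimit2_def is_cocone_subcat_iff)
  ultimately show "is_colimit X x s c' \<gamma>'"
    by (intro is_colimit_transport[of x s c \<gamma> c' \<gamma>' u v]) (simp_all add: hom_subcat_iff subcat_sel)
qed

theorem Cauchy_cocomplete2_iff:
  assumes S: "condition_S X S"
  shows "Cauchy_cocomplete2 X S \<longleftrightarrow>
    has_sequential_colimits (subcat X S) \<and> inclusion_preserves_sequential_colimits X S"
proof (intro iffI conjI)
  assume CC: "Cauchy_cocomplete2 X S"
  show "has_sequential_colimits (subcat X S)"
    unfolding has_sequential_colimits_def
    using sequence_subcat_normed_colimit2[OF CC] normed_colimit2_imp_colimit_subcat by metis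
  show "inclusion_preserves_sequential_colimits X S"
    using CC by (rule Cauchy_cocomplete2_imp_preserves)
next
  assume *: "has_sequential_colimits (subcat X S) \<and> inclusion_preserves_sequential_colimits X S"
  show "Cauchy_cocomplete2 X S"
    unfolding Cauchy_cocomplete2_def
  proof (intro allI impI, elim conjE)
    fix x s assume s: "is_sequence X x s" and "Cauchy_seq2 S s"
    then obtain N where N: "\<And>m n. N \<le> m \<Longrightarrow> m \<le> n \<Longrightarrow> s m n \<in> S"
      unfolding Cauchy_seq2_def by blast
    \<comment> \<open>All transition morphisms of this tail have indices from \<open>N\<close> on,
      hence lie in \<open>S\<close>.\<close>
    let ?x = "\<lambda>n. x (n + N)" and ?s = "\<lambda>m n. s (m + N) (n + N)"
    have s': "is_sequence (subcat X S) ?x ?s"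
      using is_sequence_shift[OF s] N by (simp add: is_sequence_subcat_iff)
    \<comment> \<open>The colimit is formed in \<open>S\<close>, so that its legs lie in
      \<open>S\<close>; preservation then makes it a colimit in \<open>X\<close>.\<close>
    with * obtain c \<gamma> where c: "is_colimit (subcat X S) ?x ?s c \<gamma>"
      unfolding has_sequential_colimits_def by blast
    with * s' have cX: "is_colimit X ?x ?s c \<gamma>"
      unfolding inclusion_preserves_sequential_colimits_def by blast
    define \<gamma>' where "\<gamma>' n = Cmp X (\<gamma> n) (s n (n + N))" for n
    have col: "is_colimit X x s c \<gamma>'" and shift: "\<And>n. \<gamma>' (n + N) = \<gamma> n"
      using is_colimit_unshift[OF s cX] by (simp_all add: \<gamma>'_def[abs_def])
    have "\<gamma> n \<in> S" for n
      using is_colimit_cocone[OF c] by (simp add: is_cocone_subcat_iff)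
    \<comment> \<open>From \<open>N\<close> on, the leg at \<open>n\<close> is the tail's leg at
      \<open>n - N\<close>.\<close>
    then have "\<gamma>' n \<in> S" if "N \<le> n" for n
      using shift[of "n - N"] that by simp
    then show "\<exists>c \<gamma>. is_normed_colimit2 X S x s c \<gamma>"
      using colimit_imp_normed_colimit2[OF S col] by blast
  qed
qed

end

theorem corollary6p4:
  fixes M :: "'p set" and d :: "'p \<Rightarrow> 'p \<Rightarrow> real"
    and X :: "('o, 'm) cat" and S :: "'m set"
  shows "(Metric_space M d \<longrightarrow>
            (Cauchy_cocomplete (indiscrete_cat M) (dist_norm d) \<longleftrightarrow> Metric_space.mcomplete M d))
       \<and> (category X \<and> wide_subcategory X S \<and> condition_S X S
            \<and> has_colimits_of_sequences_in X S \<longrightarrow>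
            (Cauchy_cocomplete2 X S \<longleftrightarrow>
               has_sequential_colimits (subcat X S) \<and> inclusion_preserves_sequential_colimits X S))"
proof (intro conjI impI; (elim conjE)?)
  show "Cauchy_cocomplete (indiscrete_cat M) (dist_norm d) \<longleftrightarrow> Metric_space.mcomplete M d"
    if "Metric_space M d"
    using that by (rule Metric_space.Cauchy_cocomplete_indiscrete_iff)
next
  assume "category X" "wide_subcategory X S" and S: "condition_S X S"
  then interpret category_with_wide_subcategory X S
    by (simp add: category_with_wide_subcategory_def category_with_wide_subcategory_axioms_def)
  show "Cauchy_cocomplete2 X S \<longleftrightarrow>
      has_sequential_colimits (subcat X S) \<and> inclusion_preserves_sequential_colimits X S"
    using S by (rule Cauchy_cocomplete2_iff)
qed

end
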